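(* Let $n$ be a positive integer divisible by $8$, and let $\mathcal{C}_1\subset\mathcal{C}_2\subset\mathcal{C}_1^\perp$ be binary codes of length $n$ with $\mathcal{C}_1$ doubly even, $\mathbf{1}\in\mathcal{C}_1$, $\dim\mathcal{C}_1=k_1$ and $\dim\mathcal{C}_2=k_1+k_2$. Then the number of quaternary even codes $\mathcal{C}$ of length $n$ containing an element of $\{\pm1\}^n$ such that $\pi(\mathcal{C})=\mathcal{C}_1$ and $\iota^{-1}(\mathcal{C})=\mathcal{C}_2$ is $2^{(n-k_1-k_2)+(k_1-1)(2n-3k_1-2-2k_2)/2}$.
   Context: $\mathbf{1}$ is the all-ones vector; $\{\pm1\}^n\subset\mathbf{Z}_4^n$ is the set of vectors all of whose coordinates are $1$ or $-1=3$. A quaternary code is a $\mathbf{Z}_4$-submodule of $\mathbf{Z}_4^n$. The Euclidean weight on $\mathbf{Z}_4$ is $\mathrm{wt}_e(0)=0$, $\mathrm{wt}_e(\pm1)=1$, $\mathrm{wt}_e(2)=4$, extended additively; a quaternary code is even if all codewords have Euclidean weight divisible by $8$. $\pi:\mathbf{Z}_4^n\to\mathbf{Z}_2^n$ is reduction mod $2$ and $\iota:\mathbf{Z}_2^n\to\mathbf{Z}_4^n$, $x\mapsto 2x$; $\pi(\mathcal{C})$ is the residue code and $\iota^{-1}(\mathcal{C})$ the torsion code. A binary code is doubly even if all Hamming weights are divisible by $4$; duals are with respect to the standard inner product. *)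

theory Defs
  imports "HOL-Analysis.Analysis" "HOL-Library.Numeral_Type" "HOL-Library.Z2"
begin

text \<open>
  The ring of integers modulo 4 is the type \<^typ>\<open>4\<close> of \<^theory>\<open>HOL-Library.Numeral_Type\<close>
  and the field with two elements is \<^typ>\<open>bit\<close>.  The length of a code is the cardinality
  \<open>CARD('n)\<close> of the finite coordinate type.
\<close>

definition binary_code :: "(bit ^ 'n) set \<Rightarrow> bool" where
  "binary_code C \<longleftrightarrow> vec.subspace C"

definition binary_dual :: "(bit ^ 'n) set \<Rightarrow> (bit ^ 'n) set" where
  "binary_dual C = {y. \<forall>x\<in>C. scalar_product x y = 0}"

definition hamming_weight :: "bit ^ 'n \<Rightarrow> nat" where
  "hamming_weight x = card {i. x $ i \<noteq> 0}"

definition doubly_even :: "(bit ^ 'n) set \<Rightarrow> bool" where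
  "doubly_even C \<longleftrightarrow> (\<forall>x\<in>C. 4 dvd hamming_weight x)"

lemma module_vec: "module ((*s) :: 'a::comm_ring_1 \<Rightarrow> 'a ^ 'n \<Rightarrow> 'a ^ 'n)"
  by unfold_locales (vector algebra_simps)+

text \<open>
  \<^const>\<open>module.subspace\<close> is the library's notion of a submodule; it makes sense here by
  \<open>module_vec\<close>.
\<close>

definition quaternary_code :: "(4 ^ 'n) set \<Rightarrow> bool" where
  "quaternary_code C \<longleftrightarrow> module.subspace (*s) C"

lemma quaternary_code_iff:
  "quaternary_code C \<longleftrightarrow>
    0 \<in> C \<and> (\<forall>x\<in>C. \<forall>y\<in>C. x + y \<in> C) \<and> (\<forall>c. \<forall>x\<in>C. c *s x \<in> C)"
  by (simp add: quaternary_code_def module.subspace_def[OF module_vec])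

lemma Z4_cases:
  fixes x :: 4
  shows "x = 0 \<or> x = 1 \<or> x = 2 \<or> x = -1"
proof -
  obtain z :: int where z: "x = of_int z" "0 \<le> z" "z < 4"
    by (cases x rule: bit0_cases) auto
  then have "z = 0 \<or> z = 1 \<or> z = 2 \<or> z = 3" by auto
  with z show ?thesis by auto
qed

definition euclidean_weight4 :: "4 \<Rightarrow> nat" where
  "euclidean_weight4 a = (if a = 0 then 0 else if a = 2 then 4 else 1)"

lemma euclidean_weight4_values:
  "euclidean_weight4 0 = 0" "euclidean_weight4 1 = 1"
  "euclidean_weight4 2 = 4" "euclidean_weight4 (-1) = 1"
  by (simp_all add: euclidean_weight4_def)

definition euclidean_weight :: "4 ^ 'n \<Rightarrow> nat" where
  "euclidean_weight x = (\<Sum>i\<in>UNIV. euclidean_weight4 (x $ i))"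

definition even_quaternary_code :: "(4 ^ 'n) set \<Rightarrow> bool" where
  "even_quaternary_code C \<longleftrightarrow>
    quaternary_code C \<and> (\<forall>x\<in>C. 8 dvd euclidean_weight x)"

text \<open>
  \<^const>\<open>Rep_bit0\<close> gives the representative of a residue class modulo 4 in
  \<open>{0, 1, 2, 3}\<close>, so the following is reduction modulo 2.
\<close>

definition reduce2 :: "4 \<Rightarrow> bit" where
  "reduce2 a = of_int (Rep_bit0 a)"

lemma reduce2_values: "reduce2 0 = 0" "reduce2 1 = 1" "reduce2 2 = 0" "reduce2 (-1) = 1"
proof -
  have "Rep_bit0 (3 :: 4) = 3"
    by (simp only: bit0.Rep_numeral) simp
  moreover have "(-1 :: 4) = 3" by simp
  ultimately have "reduce2 (-1) = of_int 3" unfolding reduce2_def by (simp only:)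
  then show "reduce2 (-1) = 1" by simp
qed (simp_all add: reduce2_def bit0.Rep_0 bit0.Rep_1 bit0.Rep_numeral)

definition residue_map :: "4 ^ 'n \<Rightarrow> bit ^ 'n" where
  "residue_map x = (\<chi> i. reduce2 (x $ i))"

text \<open>The map \<open>x \<mapsto> 2x\<close>, with each bit lifted to 0 or 1 modulo 4.\<close>

definition torsion_map :: "bit ^ 'n \<Rightarrow> 4 ^ 'n" where
  "torsion_map x = (\<chi> i. 2 * (if x $ i = 1 then 1 else 0))"

definition residue_code :: "(4 ^ 'n) set \<Rightarrow> (bit ^ 'n) set" where
  "residue_code C = residue_map ` C"

definition torsion_code :: "(4 ^ 'n) set \<Rightarrow> (bit ^ 'n) set" where
  "torsion_code C = torsion_map -` C"

definition pm1_vectors :: "(4 ^ 'n) set" where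
  "pm1_vectors = {v. \<forall>i. v $ i = 1 \<or> v $ i = -1}"

end

theory Submission
  imports Defs
begin

text \<open>
  The residue code is built up one basis vector at a time, starting with the all-ones vector.
  If \<open>e \<notin> D\<close>, an even code with residue code \<open>D + \<langle>e\<rangle>\<close> together with a codeword \<open>w\<close> lifting
  \<open>e\<close> amounts to an even code \<open>C\<close> with residue code \<open>D\<close> together with a lift \<open>w\<close> of \<open>e\<close> that is
  orthogonal to \<open>C\<close> and has Euclidean weight divisible by 8, because
  \<open>wt(v + w) = wt(v) + wt(w) + 2 v \<cdot> w\<close> modulo 8.  Writing \<open>w\<close> as a fixed lift plus
  \<open>2u\<close> turns these conditions into an affine system for \<open>u\<close> over the field with two elements:
  orthogonality prescribes \<open>x \<cdot> u\<close> for \<open>x\<close> in a basis of \<open>D\<close>, and, as the all-ones vector lies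
  in \<open>D\<close>, the weight condition then prescribes \<open>e \<cdot> u\<close>.  Thus there are
  \<open>2 ^ (n - dim D - 1)\<close> admissible lifts, of which the lifts lying in one and the same code form a
  coset of the torsion code.  For \<open>D = 0\<close> and \<open>e\<close> the all-ones vector every lift is admissible, since
  8 divides \<open>n\<close>.  Every code whose residue code contains the all-ones vector has
  an element with all coordinates \<open>\<plusminus>1\<close>.
\<close>

text \<open>The default simplification rules turn \<open>+\<close> and \<open>*\<close> on \<^typ>\<open>bit\<close> into bit operations,
  which defeats the ring normalisation used below.\<close>

declare add_bit_eq_xor [simp del] mult_bit_eq_and [simp del]

section \<open>Linear algebra over the field with two elements\<close>

lemma UNIV_bit: "(UNIV :: bit set) = {0, 1}"
  by auto

instance bit :: finite
  by standard (simp add: UNIV_bit)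

lemma CARD_bit [simp]: "CARD(bit) = 2"
  by (simp add: UNIV_bit)

lemma bit_vec_add_self [simp]: "x + x = (0 :: bit ^ 'n)"
  by (simp add: vec_eq_iff flip: mult_2)

lemma bit_vec_add_cancel [simp]: "x + (x + y) = (y :: bit ^ 'n)"
  by (simp flip: add.assoc)

lemma scalar_product_add_left:
  fixes x y z :: "'a :: semiring_1 ^ 'n"
  shows "scalar_product (x + y) z = scalar_product x z + scalar_product y z"
  by (simp add: scalar_product_def distrib_right sum.distrib)

lemma scalar_product_add_right:
  fixes x y z :: "'a :: semiring_1 ^ 'n"
  shows "scalar_product x (y + z) = scalar_product x y + scalar_product x z"
  by (simp add: scalar_product_def distrib_left sum.distrib)

lemma scalar_product_commute:
  fixes x y :: "'a :: comm_semiring_1 ^ 'n"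
  shows "scalar_product x y = scalar_product y x"
  by (simp add: scalar_product_def mult.commute)

lemma scalar_product_0_left [simp]: "scalar_product 0 x = 0"
  by (simp add: scalar_product_def)

lemma subspace_bit_iff:
  fixes V :: "(bit ^ 'n) set"
  shows "vec.subspace V \<longleftrightarrow> 0 \<in> V \<and> (\<forall>x\<in>V. \<forall>y\<in>V. x + y \<in> V)"
proof -
  have "c *s x \<in> V" if "0 \<in> V" "x \<in> V" for c and x :: "bit ^ 'n"
    using that by (cases c) auto
  then show ?thesis
    by (auto simp: vec.subspace_def)
qed

lemma span_insert_bit:
  fixes S :: "(bit ^ 'n) set"
  shows "vec.span (insert e S) = vec.span S \<union> (+) e ` vec.span S"
proof (rule set_eqI)
  fix x :: "bit ^ 'n"
  have "x \<in> vec.span (insert e S) \<longleftrightarrow> x \<in> vec.span S \<or> x - e \<in> vec.span S"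
    unfolding vec.span_breakdown_eq
  proof
    assume "\<exists>k. x - k *s e \<in> vec.span S"
    then obtain k where "x - k *s e \<in> vec.span S" by blast
    then show "x \<in> vec.span S \<or> x - e \<in> vec.span S"
      by (cases k) auto
  next
    assume "x \<in> vec.span S \<or> x - e \<in> vec.span S"
    then show "\<exists>k. x - k *s e \<in> vec.span S"
      by (auto intro: exI[of _ 0] exI[of _ 1])
  qed
  also have "x - e \<in> vec.span S \<longleftrightarrow> x \<in> (+) e ` vec.span S"
    by (auto simp: image_iff algebra_simps intro!: bexI[of _ "x - e"])
  finally show "x \<in> vec.span (insert e S) \<longleftrightarrow> x \<in> vec.span S \<union> (+) e ` vec.span S"
    by simp
qed

lemma translate_disjoint:
  fixes V :: "(bit ^ 'n) set"
  assumes "vec.subspace V" "e \<notin> V" "x \<in> V"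
  shows "e + x \<notin> V"
  using assms vec.subspace_diff[of V "e + x" x] by auto

lemma card_span_bit:
  fixes S :: "(bit ^ 'n) set"
  assumes "finite S" "vec.independent S"
  shows "card (vec.span S) = 2 ^ card S"
  using assms
proof (induction S rule: finite_induct)
  case empty
  then show ?case by simp
next
  case (insert e S)
  then have "e \<notin> vec.span S" and ind: "vec.independent S"
    by (simp_all add: vec.independent_insert)
  then have "vec.span S \<inter> (+) e ` vec.span S = {}"
    using translate_disjoint[OF vec.subspace_span] by auto
  then show ?case
    using insert ind by (simp add: span_insert_bit card_Un_disjoint card_image)
qed

lemma card_subspace_bit:
  fixes V :: "(bit ^ 'n) set"
  assumes "vec.subspace V"
  shows "card V = 2 ^ vec.dim V"
proof -
  obtain B where B: "B \<subseteq> V" "vec.independent B" "V \<subseteq> vec.span B" "card B = vec.dim V"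
    using vec.basis_exists[of V] .
  then have "vec.span B = V"
    using assms by (simp add: vec.span_subspace)
  then show ?thesis
    using card_span_bit[of B] B finite[of B] by simp
qed

text \<open>Extend the map fixing \<open>e\<close> and killing \<open>S\<close> to a linear map. At
  a coordinate where \<open>e\<close> is nonzero, the corresponding row of its matrix represents the
  required functional.\<close>

lemma separating_vector:
  fixes S :: "(bit ^ 'n) set"
  assumes "vec.independent (insert e S)" "e \<notin> S"
  obtains z where "\<And>x. x \<in> S \<Longrightarrow> scalar_product x z = 0" "scalar_product e z = 1"
proof -
  obtain f where f: "Vector_Spaces.linear (*s) (*s) f"
    and f_val: "\<forall>x\<in>insert e S. f x = (if x = e then e else 0)"
    using vec.linear_independent_extend[OF assms(1), of "\<lambda>x. if x = e then e else 0"]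
    by blast
  have "e \<noteq> 0"
    using assms(1) vec.dependent_zero by blast
  then obtain i where i: "e $ i = 1"
    by (auto simp: vec_eq_iff)
  have "scalar_product x (row i (matrix f)) = f x $ i" for x
    using matrix_works[OF f, of x]
    by (simp add: scalar_product_def row_def matrix_vector_mult_def vec_eq_iff mult.commute)
  moreover have "f e = e" "\<And>x. x \<in> S \<Longrightarrow> f x = 0"
    using f_val assms(2) by auto
  ultimately show thesis
    using that[of "row i (matrix f)"] i by simp
qed

text \<open>Each further independent equation halves the number of solutions. The product form
  avoids subtraction in the exponent.\<close>

lemma card_affine_solutions:
  fixes S :: "(bit ^ 'n) set"
  assumes "finite S" "vec.independent S"
  shows "card {u. \<forall>x\<in>S. scalar_product x u = g x} * 2 ^ card S = 2 ^ CARD('n)"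
  using assms
proof (induction S rule: finite_induct)
  case empty
  then show ?case by simp
next
  case (insert e S)
  obtain z where z: "\<And>x. x \<in> S \<Longrightarrow> scalar_product x z = 0" "scalar_product e z = 1"
    using separating_vector insert by metis
  define A where "A c = {u. (\<forall>x\<in>S. scalar_product x u = g x) \<and> scalar_product e u = c}" for c
  \<comment> \<open>Translation by \<open>z\<close> keeps the equations for \<open>S\<close> and
    flips the value at \<open>e\<close>. As 1 + 1 = 0, it injects \<open>A 0\<close> into
    \<open>A 1\<close> and back.\<close>
  have "(+) z ` A c \<subseteq> A (c + 1)" for c
    using z by (auto simp: A_def scalar_product_add_right)
  then have "card (A c) \<le> card (A (c + 1))" for c
    by (rule card_inj_on_le[rotated]) (auto simp: finite)
  from this[of 0] this[of 1] have eq: "card (A 0) = card (A 1)"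
    by simp
  have "{u. \<forall>x\<in>S. scalar_product x u = g x} = A 0 \<union> A 1" "A 0 \<inter> A 1 = {}"
    by (auto simp: A_def)
  then have "card {u. \<forall>x\<in>S. scalar_product x u = g x} = card (A 0) + card (A 1)"
    by (simp add: card_Un_disjoint)
  also have "\<dots> = 2 * card (A (g e))"
    using eq by (cases "g e") auto
  also have "A (g e) = {u. \<forall>x\<in>insert e S. scalar_product x u = g x}"
    by (auto simp: A_def)
  finally show ?case
    using insert by (simp add: vec.independent_insert)
qed

section \<open>Scalars modulo 2, 4 and 8\<close>

text \<open>The group embeddings \<open>x \<mapsto> 2x\<close> from bits to residues modulo 4, and from there to
  residues modulo 8.\<close>

definition twice :: "bit \<Rightarrow> 4" where
  "twice b = 2 * (if b = 1 then 1 else 0)"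

definition double :: "4 \<Rightarrow> 8" where
  "double a = (if a = 0 then 0 else if a = 1 then 2 else if a = 2 then 4 else 6)"

lemma double_add: "double (a + b) = double a + double b"
  using Z4_cases[of a] Z4_cases[of b] by (auto simp: double_def)

lemma double_eq_0_iff [simp]: "double a = 0 \<longleftrightarrow> a = 0"
  using Z4_cases[of a] by (auto simp: double_def)

lemma double_sum: "double (sum f A) = (\<Sum>i\<in>A. double (f i))"
  using sum_comp_morphism[of double f A] by (simp add: double_add o_def)

lemma twice_eq_0_iff [simp]: "twice b = 0 \<longleftrightarrow> b = 0"
  by (cases b) (auto simp: twice_def)

lemma twice_add: "twice (a + b) = twice a + twice b"
  by (cases a; cases b) (auto simp: twice_def)

lemma twice_sum: "twice (sum f A) = (\<Sum>i\<in>A. twice (f i))"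
  using sum_comp_morphism[of twice f A] by (simp add: twice_add o_def)

lemma reduce2_eq: "reduce2 a = (if a = 0 \<or> a = 2 then 0 else 1)"
  using Z4_cases[of a] reduce2_values by auto

lemma reduce2_add: "reduce2 (a + b) = reduce2 a + reduce2 b"
  using Z4_cases[of a] Z4_cases[of b] by (auto simp: reduce2_eq)

lemma reduce2_mult: "reduce2 (a * b) = reduce2 a * reduce2 b"
  using Z4_cases[of a] Z4_cases[of b] by (auto simp: reduce2_eq)

lemma reduce2_sum: "reduce2 (sum f A) = (\<Sum>i\<in>A. reduce2 (f i))"
  using sum_comp_morphism[of reduce2 f A] by (simp add: reduce2_add reduce2_values o_def)

lemma reduce2_twice [simp]: "reduce2 (twice b) = 0"
  by (cases b) (auto simp: twice_def reduce2_values)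

lemma mult_twice: "a * twice b = twice (reduce2 a * b)"
  using Z4_cases[of a] by (cases b) (auto simp: twice_def reduce2_eq)

lemma reduce2_eq_0D: "reduce2 a = 0 \<Longrightarrow> \<exists>b. a = twice b"
  using Z4_cases[of a] by (auto simp: twice_def reduce2_eq split: if_splits)

section \<open>Reduction and doubling of vectors\<close>

lemma torsion_map_nth [simp]: "torsion_map x $ i = twice (x $ i)"
  by (simp add: torsion_map_def twice_def)

lemma residue_map_nth [simp]: "residue_map x $ i = reduce2 (x $ i)"
  by (simp add: residue_map_def)

lemma torsion_map_add: "torsion_map (x + y) = torsion_map x + torsion_map y"
  by (simp add: vec_eq_iff twice_add)

lemma torsion_map_0 [simp]: "torsion_map 0 = 0"
  by (simp add: vec_eq_iff)

lemma torsion_map_eq_0_iff [simp]: "torsion_map x = 0 \<longleftrightarrow> x = 0"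
  by (simp add: vec_eq_iff)

lemma torsion_map_add_self [simp]: "torsion_map x + torsion_map x = 0"
  by (simp flip: torsion_map_add)

lemma inj_torsion_map: "inj torsion_map"
proof (rule injI)
  fix x y :: "bit ^ 'n"
  assume "torsion_map x = torsion_map y"
  then have "torsion_map (x + y) = 0"
    by (simp add: torsion_map_add)
  then have "x + (x + y) = x"
    by simp
  then show "x = y"
    by simp
qed

lemma residue_map_add: "residue_map (x + y) = residue_map x + residue_map y"
  by (simp add: vec_eq_iff reduce2_add)

lemma residue_map_0 [simp]: "residue_map 0 = 0"
  by (simp add: vec_eq_iff reduce2_values)

lemma residue_map_torsion_map [simp]: "residue_map (torsion_map x) = 0"
  by (simp add: vec_eq_iff)

lemma add_self_eq_torsion_map: "x + x = torsion_map (residue_map x)"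
proof -
  have "a + a = twice (reduce2 a)" for a
    using Z4_cases[of a] by (auto simp: twice_def reduce2_eq)
  then show ?thesis
    by (simp add: vec_eq_iff)
qed

lemma residue_map_eq_iff:
  "residue_map v = residue_map w \<longleftrightarrow> (\<exists>u. v = w + torsion_map u)"
proof
  assume eq: "residue_map v = residue_map w"
  have "\<exists>b. v $ i = w $ i + twice b" for i
  proof -
    have "reduce2 (v $ i - w $ i) + reduce2 (w $ i) = reduce2 (v $ i)"
      by (simp flip: reduce2_add)
    also have "\<dots> = reduce2 (w $ i)"
      using eq by (simp add: vec_eq_iff)
    finally have "reduce2 (v $ i - w $ i) = 0"
      by simp
    then show ?thesis
      by (metis reduce2_eq_0D add.commute diff_add_cancel)
  qed
  then obtain b where "\<And>i. v $ i = w $ i + twice (b i)"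
    by metis
  then have "v = w + torsion_map (\<chi> i. b i)"
    by (simp add: vec_eq_iff)
  then show "\<exists>u. v = w + torsion_map u" ..
qed (auto simp: residue_map_add)

lemma scalar_product_torsion_map:
  "scalar_product v (torsion_map u) = twice (scalar_product (residue_map v) u)"
  by (simp add: scalar_product_def mult_twice twice_sum)

lemma reduce2_scalar_product:
  "reduce2 (scalar_product v w) = scalar_product (residue_map v) (residue_map w)"
  by (simp add: scalar_product_def reduce2_sum reduce2_mult)

section \<open>The Euclidean weight modulo 8 as a quadratic form\<close>

text \<open>The square of a residue modulo 4 is well defined modulo 8 and equals its Euclidean
  weight there, so this is the sum of the squares of the coordinates.\<close>

definition weight_mod8 :: "4 ^ 'n \<Rightarrow> 8" where
  "weight_mod8 x = of_nat (euclidean_weight x)"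

lemma weight_mod8_eq_0_iff: "weight_mod8 x = 0 \<longleftrightarrow> 8 dvd euclidean_weight x"
  by (simp add: weight_mod8_def of_nat_eq_0_iff_char_dvd)

text \<open>Coordinatewise this is (a + b)^2 = a^2 + b^2 + 2ab modulo 8.\<close>

lemma weight_mod8_add:
  "weight_mod8 (v + w) = weight_mod8 v + weight_mod8 w + double (scalar_product v w)"
proof -
  have "(of_nat (euclidean_weight4 (a + b)) :: 8) =
      of_nat (euclidean_weight4 a) + of_nat (euclidean_weight4 b) + double (a * b)" for a b
    using Z4_cases[of a] Z4_cases[of b] by (auto simp: double_def euclidean_weight4_def)
  then show ?thesis
    by (simp add: weight_mod8_def euclidean_weight_def scalar_product_def double_sum sum.distrib)
qed

lemma weight_mod8_torsion_map:
  "weight_mod8 (torsion_map u) = double (twice (scalar_product (\<chi> i. 1) u))"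
proof -
  have "(of_nat (euclidean_weight4 (twice b)) :: 8) = double (twice b)" for b
    by (cases b) (auto simp: twice_def double_def euclidean_weight4_def)
  then show ?thesis
    by (simp add: weight_mod8_def euclidean_weight_def scalar_product_def double_sum twice_sum)
qed

definition lift :: "bit ^ 'n \<Rightarrow> 4 ^ 'n" where
  "lift x = (\<chi> i. if x $ i = 1 then 1 else 0)"

lemma residue_map_lift [simp]: "residue_map (lift x) = x"
  by (auto simp: vec_eq_iff lift_def reduce2_values)

lemma euclidean_weight_lift: "euclidean_weight (lift x) = hamming_weight x"
proof -
  have "euclidean_weight (lift x) = (\<Sum>i\<in>UNIV. if x $ i \<noteq> 0 then 1 else 0)"
    unfolding euclidean_weight_def
    by (rule sum.cong) (auto simp: lift_def euclidean_weight4_def)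
  then show ?thesis
    by (simp add: hamming_weight_def flip: sum.inter_filter)
qed

text \<open>A multiple of 4 is 0 or 4 modulo 8, and these are the two values of
  \<open>double (twice h)\<close>.\<close>

lemma weight_mod8_lift:
  assumes "4 dvd hamming_weight x"
  shows "\<exists>h. weight_mod8 (lift x) = double (twice h)"
proof -
  obtain k where k: "hamming_weight x = 4 * k"
    using assms by blast
  show ?thesis
  proof (cases "even k")
    case True
    then have "weight_mod8 (lift x) = 0"
      using k by (auto simp: weight_mod8_eq_0_iff euclidean_weight_lift)
    then show ?thesis
      by (intro exI[of _ 0]) simp
  next
    case False
    then obtain j where "k = 2 * j + 1"
      by (rule oddE)
    then have "euclidean_weight (lift x) = 8 * j + 4"
      using k by (simp add: euclidean_weight_lift)
    then have "weight_mod8 (lift x) = of_nat (8 * j) + of_nat 4"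
      by (simp only: weight_mod8_def of_nat_add)
    also have "of_nat (8 * j) = (0 :: 8)"
      by (simp only: of_nat_eq_0_iff_char_dvd) simp
    also have "0 + of_nat 4 = double (twice 1)"
      by (simp add: double_def twice_def)
    finally show ?thesis ..
  qed
qed

section \<open>Extending and restricting even codes\<close>

lemma quaternary_code_iff_add_closed:
  "quaternary_code C \<longleftrightarrow> 0 \<in> C \<and> (\<forall>x\<in>C. \<forall>y\<in>C. x + y \<in> C)"
proof -
  have "(4 :: 4) = 0"
    by simp
  then have four_mult: "4 * a = 0" for a :: 4
    by (metis mult_zero_left)
  have "c *s x \<in> C" if "0 \<in> C" "\<forall>x\<in>C. \<forall>y\<in>C. x + y \<in> C" "x \<in> C" for c x
  proof -
    have "2 *s x = x + x" "(-1) *s x = x + (x + x)"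
      by (simp_all add: vec_eq_iff four_mult flip: mult_2)
    then have "2 *s x \<in> C" "(-1) *s x \<in> C"
      using that by metis+
    then show ?thesis
      using that Z4_cases[of c] by auto
  qed
  then show ?thesis
    by (auto simp: quaternary_code_iff)
qed

lemma quaternary_code_diff:
  assumes "quaternary_code C" "x \<in> C" "y \<in> C"
  shows "x - y \<in> C"
proof -
  have "x + (-1) *s y \<in> C"
    using assms by (simp add: quaternary_code_iff)
  moreover have "x + (-1) *s y = x - y"
    by (simp add: vec_eq_iff)
  ultimately show ?thesis
    by simp
qed

lemma even_quaternary_code_iff:
  "even_quaternary_code C \<longleftrightarrow> quaternary_code C \<and> (\<forall>x\<in>C. weight_mod8 x = 0)"
  by (simp add: even_quaternary_code_def weight_mod8_eq_0_iff)

text \<open>Polarisation: the weights of \<open>v\<close>, \<open>w\<close> and \<open>v + w\<close>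
  all vanish modulo 8, hence so does \<open>double (scalar_product v w)\<close>.\<close>

lemma even_quaternary_code_scalar_product:
  assumes "even_quaternary_code C" "v \<in> C" "w \<in> C"
  shows "scalar_product v w = 0"
  using assms weight_mod8_add[of v w]
  by (simp add: even_quaternary_code_iff quaternary_code_iff)

definition even_codes :: "(bit ^ 'n) set \<Rightarrow> (bit ^ 'n) set \<Rightarrow> (4 ^ 'n) set set" where
  "even_codes D E = {C. even_quaternary_code C \<and> residue_code C = D \<and> torsion_code C = E}"

text \<open>Two cosets already form a code when \<open>C\<close> is a code containing
  \<open>w + w\<close>.\<close>

definition adjoin :: "4 ^ 'n \<Rightarrow> (4 ^ 'n) set \<Rightarrow> (4 ^ 'n) set" where
  "adjoin w C = C \<union> (+) w ` C"

definition residue_restrict :: "(bit ^ 'n) set \<Rightarrow> (4 ^ 'n) set \<Rightarrow> (4 ^ 'n) set" where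
  "residue_restrict D C = {c \<in> C. residue_map c \<in> D}"

text \<open>Since \<open>w + w = torsion_map e\<close> and \<open>e \<in> E\<close>, the two cosets
  are closed under addition. Words of the new coset have residues in \<open>e + D\<close>, which is
  disjoint from \<open>D\<close>; so the torsion code is unchanged and restricting to
  \<open>D\<close> recovers \<open>C\<close>.\<close>

lemma adjoin_in_even_codes:
  assumes C: "C \<in> even_codes D E" and D: "vec.subspace D" "e \<notin> D" and "e \<in> E"
    and w: "residue_map w = e" "weight_mod8 w = 0" "\<And>v. v \<in> C \<Longrightarrow> scalar_product v w = 0"
  shows "adjoin w C \<in> even_codes (D \<union> (+) e ` D) E"
    and "residue_restrict D (adjoin w C) = C"
proof -
  have C0: "0 \<in> C" and C_add: "\<And>x y. x \<in> C \<Longrightarrow> y \<in> C \<Longrightarrow> x + y \<in> C"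
    and C_weight: "\<And>x. x \<in> C \<Longrightarrow> weight_mod8 x = 0"
    and res: "residue_map ` C = D" and tor: "torsion_map -` C = E"
    using C by (simp_all add: even_codes_def even_quaternary_code_iff quaternary_code_iff
        residue_code_def torsion_code_def)
  have "w + w \<in> C"
    using tor w(1) \<open>e \<in> E\<close> by (auto simp: add_self_eq_torsion_map)
  then have ww: "w + x + (w + y) \<in> C" if "x \<in> C" "y \<in> C" for x y
    using C_add[OF _ C_add[OF that]] by (metis add.assoc add.commute)
  have outside: "residue_map (w + c) \<notin> D" if "c \<in> C" for c
    using translate_disjoint[OF D, of "residue_map c"] res w(1) that by (auto simp: residue_map_add)
  have "quaternary_code (adjoin w C)"
    unfolding quaternary_code_iff_add_closed adjoin_def
    using C0 C_add ww by (auto simp: image_iff add_ac intro: bexI[of _ "_ + _"])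
  moreover have "weight_mod8 (w + x) = 0" if "x \<in> C" for x
    using that C_weight w by (simp add: weight_mod8_add scalar_product_commute[of w])
  then have "\<forall>x\<in>adjoin w C. weight_mod8 x = 0"
    using C_weight by (auto simp: adjoin_def)
  moreover have "residue_code (adjoin w C) = D \<union> (+) e ` D"
    using res w(1) by (auto simp: residue_code_def adjoin_def residue_map_add image_Un image_image)
  moreover have "torsion_code (adjoin w C) = E"
  proof -
    have "torsion_map x \<notin> (+) w ` C" for x
    proof
      assume "torsion_map x \<in> (+) w ` C"
      then have "residue_map (torsion_map x) \<notin> D"
        using outside by (metis imageE)
      then show False
        using D(1) by (simp add: vec.subspace_0)
    qed
    then show ?thesis
      using tor by (auto simp: torsion_code_def adjoin_def)
  qed
  ultimately show "adjoin w C \<in> even_codes (D \<union> (+) e ` D) E"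
    by (simp add: even_codes_def even_quaternary_code_iff)
  show "residue_restrict D (adjoin w C) = C"
    using res outside by (auto simp: residue_restrict_def adjoin_def)
qed

text \<open>This makes restriction inverse to adjoining \<open>w\<close>: a codeword with residue in
  \<open>e + D\<close> becomes one with residue in \<open>D\<close> after subtracting
  \<open>w\<close>.\<close>

lemma residue_restrict_in_even_codes:
  assumes C: "C \<in> even_codes (D \<union> (+) e ` D) E" and D: "vec.subspace D"
    and w: "w \<in> C" "residue_map w = e"
  shows "residue_restrict D C \<in> even_codes D E"
    and "adjoin w (residue_restrict D C) = C"
proof -
  have quat: "quaternary_code C"
    and C_weight: "\<And>x. x \<in> C \<Longrightarrow> weight_mod8 x = 0"
    and res: "residue_map ` C = D \<union> (+) e ` D" and tor: "torsion_map -` C = E"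
    using C by (simp_all add: even_codes_def even_quaternary_code_iff
        residue_code_def torsion_code_def)
  have "quaternary_code (residue_restrict D C)"
    using quat D
    by (auto simp: quaternary_code_iff_add_closed residue_restrict_def subspace_bit_iff residue_map_add)
  moreover have "residue_code (residue_restrict D C) = D"
    using res by (auto simp: residue_code_def residue_restrict_def)
  moreover have "torsion_code (residue_restrict D C) = E"
    using tor D by (auto simp: torsion_code_def residue_restrict_def vec.subspace_0)
  ultimately show "residue_restrict D C \<in> even_codes D E"
    using C_weight by (simp add: even_codes_def even_quaternary_code_iff residue_restrict_def)
  show "adjoin w (residue_restrict D C) = C"
  proof
    show "adjoin w (residue_restrict D C) \<subseteq> C"
      using quat w by (auto simp: adjoin_def residue_restrict_def quaternary_code_iff)
    show "C \<subseteq> adjoin w (residue_restrict D C)"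
    proof
      fix c assume c: "c \<in> C"
      show "c \<in> adjoin w (residue_restrict D C)"
      proof (cases "residue_map c \<in> D")
        case True
        then show ?thesis
          using c by (simp add: adjoin_def residue_restrict_def)
      next
        case False
        then obtain d where d: "residue_map c = e + d" "d \<in> D"
          using res c by blast
        have "residue_map c = residue_map w + residue_map (c - w)"
          by (simp flip: residue_map_add)
        \<comment> \<open>Adding \<open>e\<close> to both sides cancels it in characteristic
          2.\<close>
        then have "e + (e + d) = e + (e + residue_map (c - w))"
          using d w(2) by simp
        then have "residue_map (c - w) \<in> D"
          using d(2) by simp
        moreover have "c - w \<in> C"
          using quat c w(1) by (rule quaternary_code_diff)
        ultimately have "c - w \<in> residue_restrict D C"
          by (simp add: residue_restrict_def)
        then have "w + (c - w) \<in> adjoin w (residue_restrict D C)"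
          unfolding adjoin_def by blast
        then show ?thesis
          by simp
      qed
    qed
  qed
qed

lemma residue_fiber:
  assumes "quaternary_code C" "w \<in> C"
  shows "{v \<in> C. residue_map v = residue_map w} = (\<lambda>u. w + torsion_map u) ` torsion_code C"
proof -
  have "w + torsion_map u \<in> C \<longleftrightarrow> torsion_map u \<in> C" for u
    using assms quaternary_code_diff[of C "w + torsion_map u" w]
    by (auto simp: quaternary_code_iff)
  then show ?thesis
    by (auto simp: residue_map_eq_iff torsion_code_def)
qed

lemma card_residue_fiber:
  assumes "quaternary_code C" "w \<in> C"
  shows "card {v \<in> C. residue_map v = residue_map w} = card (torsion_code C)"
  unfolding residue_fiber[OF assms]
  by (rule card_image) (simp add: inj_on_def inj_eq[OF inj_torsion_map])

section \<open>Counting the extensions by one residue vector\<close>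

definition admissible_lifts :: "bit ^ 'n \<Rightarrow> (4 ^ 'n) set \<Rightarrow> (4 ^ 'n) set" where
  "admissible_lifts e C =
    {w. residue_map w = e \<and> weight_mod8 w = 0 \<and> (\<forall>v\<in>C. scalar_product v w = 0)}"

text \<open>Double counting of pairs of a larger code and a codeword \<open>w\<close> in it over
  \<open>e\<close>. Each larger code has \<open>card E\<close> such \<open>w\<close>, a coset of its
  torsion; restriction to \<open>D\<close> identifies the pairs with codes over \<open>D\<close>
  equipped with an admissible lift.\<close>

lemma card_even_codes_adjoin:
  assumes D: "vec.subspace D" "e \<notin> D" and "e \<in> E"
    and K: "\<And>C. C \<in> even_codes D E \<Longrightarrow> card (admissible_lifts e C) = K"
  shows "card (even_codes (D \<union> (+) e ` D) E) * card E = card (even_codes D E) * K"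
proof -
  define D' where "D' = D \<union> (+) e ` D"
  define fiber where "fiber C = {v \<in> C. residue_map v = e}" for C
  have "card (fiber C) = card E" if C: "C \<in> even_codes D' E" for C
  proof -
    have "e \<in> D'"
      using D(1) by (auto simp: D'_def vec.subspace_0 image_iff intro: bexI[of _ 0])
    then obtain w where "w \<in> C" "e = residue_map w"
      using C by (auto simp: even_codes_def residue_code_def)
    then show ?thesis
      using C card_residue_fiber[of C w]
      by (simp add: even_codes_def even_quaternary_code_iff fiber_def)
  qed
  then have "card (even_codes D' E) * card E = card (SIGMA C:even_codes D' E. fiber C)"
    by simp
  also have "\<dots> = card (SIGMA C:even_codes D E. admissible_lifts e C)"
  proof (rule bij_betw_same_card)
    show "bij_betw (\<lambda>(C, w). (residue_restrict D C, w)) (SIGMA C:even_codes D' E. fiber C)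
        (SIGMA C:even_codes D E. admissible_lifts e C)"
    proof (rule bij_betw_byWitness[where f' = "\<lambda>(C, w). (adjoin w C, w)"])
      show "\<forall>p\<in>SIGMA C:even_codes D' E. fiber C.
          (\<lambda>(C, w). (adjoin w C, w)) ((\<lambda>(C, w). (residue_restrict D C, w)) p) = p"
        using residue_restrict_in_even_codes(2)[OF _ D(1)] by (auto simp: D'_def fiber_def)
      show "\<forall>p\<in>SIGMA C:even_codes D E. admissible_lifts e C.
          (\<lambda>(C, w). (residue_restrict D C, w)) ((\<lambda>(C, w). (adjoin w C, w)) p) = p"
        using adjoin_in_even_codes(2)[OF _ D \<open>e \<in> E\<close>] by (auto simp: admissible_lifts_def)
      show "(\<lambda>(C, w). (residue_restrict D C, w)) ` (SIGMA C:even_codes D' E. fiber C)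
          \<subseteq> (SIGMA C:even_codes D E. admissible_lifts e C)"
      proof clarify
        fix C w assume C: "C \<in> even_codes D' E" and w: "w \<in> fiber C"
        then have "even_quaternary_code C"
          by (simp add: even_codes_def)
        then have "w \<in> admissible_lifts e (residue_restrict D C)"
          using w even_quaternary_code_scalar_product[of C _ w]
          by (auto simp: admissible_lifts_def residue_restrict_def fiber_def even_quaternary_code_iff)
        then show "residue_restrict D C \<in> even_codes D E \<and> w \<in> admissible_lifts e (residue_restrict D C)"
          using residue_restrict_in_even_codes(1)[OF _ D(1)] C w by (auto simp: D'_def fiber_def)
      qed
      show "(\<lambda>(C, w). (adjoin w C, w)) ` (SIGMA C:even_codes D E. admissible_lifts e C)
          \<subseteq> (SIGMA C:even_codes D' E. fiber C)"
      proof clarify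
        fix C w assume C: "C \<in> even_codes D E" and w: "w \<in> admissible_lifts e C"
        have "0 \<in> C"
          using C by (simp add: even_codes_def even_quaternary_code_iff quaternary_code_iff)
        then have "w \<in> adjoin w C"
          by (auto simp: adjoin_def image_iff intro: bexI[of _ 0])
        then show "adjoin w C \<in> even_codes D' E \<and> w \<in> fiber (adjoin w C)"
          using adjoin_in_even_codes(1)[OF C D \<open>e \<in> E\<close>] w
          by (auto simp: admissible_lifts_def fiber_def D'_def)
      qed
    qed
  qed
  also have "\<dots> = card (even_codes D E) * K"
    using K by simp
  finally show ?thesis
    by (simp add: D'_def)
qed

text \<open>Residues of codewords orthogonal to \<open>w\<close> form a subspace; once it contains
  \<open>S\<close>, it is all of \<open>vec.span S\<close>. Every codeword then differs from an
  orthogonal one by some \<open>torsion_map u\<close> with \<open>u \<in> E\<close>, which is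
  orthogonal to \<open>w\<close> because \<open>e\<close> is orthogonal to \<open>E\<close>.\<close>

lemma orthogonal_lift_iff:
  assumes C: "C \<in> even_codes (vec.span S) E" and E: "\<And>c. c \<in> E \<Longrightarrow> scalar_product e c = 0"
    and w: "residue_map w = e" and v: "\<And>x. x \<in> S \<Longrightarrow> v x \<in> C \<and> residue_map (v x) = x"
  shows "(\<forall>c\<in>C. scalar_product c w = 0) \<longleftrightarrow> (\<forall>x\<in>S. scalar_product (v x) w = 0)"
proof
  assume orth: "\<forall>x\<in>S. scalar_product (v x) w = 0"
  have quat: "quaternary_code C" and res: "residue_map ` C = vec.span S" and tor: "torsion_code C = E"
    using C by (simp_all add: even_codes_def even_quaternary_code_iff residue_code_def)
  define T where "T = residue_map ` {c \<in> C. scalar_product c w = 0}"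
  have "vec.subspace T"
    unfolding subspace_bit_iff
  proof (intro conjI ballI)
    show "0 \<in> T"
      using quat by (auto simp: T_def quaternary_code_iff image_iff intro!: exI[of _ 0])
    fix x y assume "x \<in> T" "y \<in> T"
    then obtain a b where "a \<in> C" "b \<in> C" "scalar_product a w = 0" "scalar_product b w = 0"
      and "x = residue_map a" "y = residue_map b"
      by (auto simp: T_def)
    then show "x + y \<in> T"
      using quat by (auto simp: T_def quaternary_code_iff scalar_product_add_left
          simp flip: residue_map_add)
  qed
  moreover have "S \<subseteq> T"
    using v orth by (force simp: T_def)
  ultimately have "vec.span S \<subseteq> T"
    by (simp add: vec.span_minimal)
  show "\<forall>c\<in>C. scalar_product c w = 0"
  proof
    fix c assume c: "c \<in> C"
    then have "residue_map c \<in> T"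
      using res \<open>vec.span S \<subseteq> T\<close> by blast
    then obtain a where a: "a \<in> C" "scalar_product a w = 0" "residue_map c = residue_map a"
      by (auto simp: T_def)
    then obtain u where u: "c = a + torsion_map u" "u \<in> E"
      using residue_fiber[OF quat a(1)] c tor by blast
    then show "scalar_product c w = 0"
      using a E[OF u(2)] w
      by (simp add: scalar_product_add_left scalar_product_torsion_map
          scalar_product_commute[of "torsion_map u" w])
  qed
qed (use v in blast)

lemma weight_mod8_lift_add_torsion_map:
  "weight_mod8 (lift e + torsion_map u) =
    weight_mod8 (lift e) + double (twice (scalar_product (\<chi> i. 1) u + scalar_product e u))"
  by (simp add: weight_mod8_add weight_mod8_torsion_map scalar_product_torsion_map
      scalar_product_commute[of "torsion_map u" "lift e"] twice_add double_add add_ac)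

lemma card_admissible_lifts:
  "card (admissible_lifts e C) = card {u. lift e + torsion_map u \<in> admissible_lifts e C}"
proof -
  have "residue_map w = e \<longleftrightarrow> (\<exists>u. w = lift e + torsion_map u)" for w
    using residue_map_eq_iff[of w "lift e"] by simp
  then have "admissible_lifts e C =
      (\<lambda>u. lift e + torsion_map u) ` {u. lift e + torsion_map u \<in> admissible_lifts e C}"
    by (auto simp: admissible_lifts_def)
  moreover have "inj (\<lambda>u. lift e + torsion_map u)"
    by (simp add: inj_on_def inj_eq[OF inj_torsion_map])
  ultimately show ?thesis
    by (metis card_image inj_on_subset subset_UNIV)
qed

lemma double_twice_add_eq_0_iff: "double (twice a) + double (twice b) = 0 \<longleftrightarrow> a = b"
  by (cases a; cases b) (simp_all flip: double_add twice_add)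

text \<open>With \<open>w = lift e + torsion_map u\<close>, admissibility becomes one equation on
  \<open>u\<close> for each element of \<open>insert e S\<close>, hence the exponent
  \<open>card S + 1\<close>.\<close>

lemma card_admissible_lifts_independent:
  fixes C :: "(4 ^ 'n) set"
  assumes C: "C \<in> even_codes (vec.span S) E" and E: "\<And>c. c \<in> E \<Longrightarrow> scalar_product e c = 0"
    and ind: "vec.independent (insert e S)" "e \<notin> S" "finite S"
    and one: "(\<chi> i. 1) \<in> S" and weight: "4 dvd hamming_weight e"
    and orth: "\<And>x. x \<in> S \<Longrightarrow> scalar_product x e = 0"
  shows "card (admissible_lifts e C) * 2 ^ (card S + 1) = 2 ^ CARD('n)"
proof -
  have "S \<subseteq> residue_map ` C"
    using C vec.span_superset[of S] by (simp add: even_codes_def residue_code_def)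
  then have "\<exists>v. v \<in> C \<and> residue_map v = x" if "x \<in> S" for x
    using that by blast
  then obtain v where v: "\<And>x. x \<in> S \<Longrightarrow> v x \<in> C \<and> residue_map (v x) = x"
    by metis
  \<comment> \<open>Modulo 2 this product is \<open>scalar_product x e\<close>, which vanishes by
    \<open>orth\<close>, so it lies in the image of \<open>twice\<close>.\<close>
  have "\<exists>b. scalar_product (v x) (lift e) = twice b" if "x \<in> S" for x
    using that v orth by (intro reduce2_eq_0D) (simp add: reduce2_scalar_product)
  then obtain b where b: "\<And>x. x \<in> S \<Longrightarrow> scalar_product (v x) (lift e) = twice (b x)"
    by metis
  obtain h where h: "weight_mod8 (lift e) = double (twice h)"
    using weight_mod8_lift[OF weight] ..
  have bit_eq: "c + d = 0 \<longleftrightarrow> d = c" "c = d + f \<longleftrightarrow> f = c + d" for c d f :: bit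
    by (cases c; cases d; cases f; simp)+
  \<comment> \<open>The weight condition fixes the sum of the products of \<open>u\<close> with the
    all-ones vector and with \<open>e\<close> to be \<open>h\<close>. The first product is
    prescribed by \<open>b\<close>, so the value required at \<open>e\<close> is
    \<open>h + b (\<chi> i. 1)\<close>.\<close>
  have "lift e + torsion_map u \<in> admissible_lifts e C \<longleftrightarrow>
      (\<forall>x\<in>insert e S. scalar_product x u = (b(e := h + b (\<chi> i. 1))) x)" for u
  proof -
    have "(\<forall>c\<in>C. scalar_product c (lift e + torsion_map u) = 0) \<longleftrightarrow>
        (\<forall>x\<in>S. scalar_product (v x) (lift e + torsion_map u) = 0)"
      by (rule orthogonal_lift_iff[OF C E _ v]) (simp_all add: residue_map_add)
    also have "\<dots> \<longleftrightarrow> (\<forall>x\<in>S. scalar_product x u = b x)"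
      using v b by (simp add: scalar_product_add_right scalar_product_torsion_map bit_eq
          flip: twice_add)
    finally have "lift e + torsion_map u \<in> admissible_lifts e C \<longleftrightarrow>
        scalar_product (\<chi> i. 1) u + scalar_product e u = h \<and> (\<forall>x\<in>S. scalar_product x u = b x)"
      by (simp add: admissible_lifts_def residue_map_add weight_mod8_lift_add_torsion_map h
          double_twice_add_eq_0_iff eq_commute[of h])
    also have "\<dots> \<longleftrightarrow> scalar_product e u = h + b (\<chi> i. 1) \<and> (\<forall>x\<in>S. scalar_product x u = b x)"
      using one bit_eq(2)[of h "b (\<chi> i. 1)" "scalar_product e u"] by auto
    also have "\<dots> \<longleftrightarrow> (\<forall>x\<in>insert e S. scalar_product x u = (b(e := h + b (\<chi> i. 1))) x)"
      using ind(2) by auto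
    finally show ?thesis .
  qed
  then show ?thesis
    using card_affine_solutions[of "insert e S" "b(e := h + b (\<chi> i. 1))"] ind
    by (simp add: card_admissible_lifts)
qed

section \<open>Residue codes of dimension 0 and 1\<close>

text \<open>Zero residue leaves only torsion words. The weight of \<open>torsion_map c\<close> is 4
  times the Hamming weight of \<open>c\<close>, and the latter is even by
  \<open>one\<close>.\<close>

lemma even_codes_residue_zero:
  assumes E: "vec.subspace E" and one: "\<And>c. c \<in> E \<Longrightarrow> scalar_product (\<chi> i. 1) c = 0"
  shows "even_codes {0} E = {torsion_map ` E}"
proof
  show "even_codes {0} E \<subseteq> {torsion_map ` E}"
  proof
    fix C assume C: "C \<in> even_codes {0} E"
    then have "quaternary_code C" "0 \<in> C" "torsion_code C = E" and "residue_map ` C = {0}"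
      by (auto simp: even_codes_def even_quaternary_code_iff quaternary_code_iff residue_code_def)
    then have "{v \<in> C. residue_map v = residue_map 0} = (\<lambda>u. 0 + torsion_map u) ` E"
      using residue_fiber[of C 0] by simp
    then show "C \<in> {torsion_map ` E}"
      using \<open>residue_map ` C = {0}\<close> by (simp add: set_eq_iff image_iff) metis
  qed
  have "quaternary_code (torsion_map ` E)"
    unfolding quaternary_code_iff_add_closed
  proof (intro conjI ballI)
    show "0 \<in> torsion_map ` E"
      using vec.subspace_0[OF E] by (auto simp: image_iff intro: bexI[of _ 0])
    show "x + y \<in> torsion_map ` E" if "x \<in> torsion_map ` E" "y \<in> torsion_map ` E" for x y
      using that vec.subspace_add[OF E] by (auto simp flip: torsion_map_add)
  qed
  moreover have "residue_code (torsion_map ` E) = {0}"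
    using vec.subspace_0[OF E] by (auto simp: residue_code_def image_image)
  ultimately show "{torsion_map ` E} \<subseteq> even_codes {0} E"
    using one by (simp add: even_codes_def even_quaternary_code_iff torsion_code_def
        weight_mod8_torsion_map inj_vimage_image_eq[OF inj_torsion_map])
qed

text \<open>For \<open>e\<close> the all-ones vector the two products with \<open>u\<close> in the
  weight formula cancel, so every lift has weight congruent to \<open>CARD('n)\<close>, that is to
  0, modulo 8; orthogonality to the torsion words is \<open>one\<close>. Hence all
  \<open>2 ^ CARD('n)\<close> lifts are admissible.\<close>

lemma card_even_codes_span_one:
  fixes E :: "(bit ^ 'n) set"
  assumes n: "8 dvd CARD('n)" and E: "vec.subspace E" "(\<chi> i. 1) \<in> E"
    and one: "\<And>c. c \<in> E \<Longrightarrow> scalar_product (\<chi> i. 1) c = 0"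
  shows "card (even_codes (vec.span {\<chi> i. 1}) E) * card E = 2 ^ CARD('n)"
proof -
  let ?one = "\<chi> i. 1 :: bit ^ 'n"
  have "card (admissible_lifts ?one C) = 2 ^ CARD('n)" if "C \<in> even_codes {0} E" for C
  proof -
    have "lift ?one + torsion_map u \<in> admissible_lifts ?one C" for u
    proof -
      have "weight_mod8 (lift ?one) = 0"
        using n by (simp add: weight_mod8_eq_0_iff euclidean_weight_lift hamming_weight_def)
      then have "weight_mod8 (lift ?one + torsion_map u) = 0"
        by (simp add: weight_mod8_lift_add_torsion_map flip: mult_2)
      then show ?thesis
        using that even_codes_residue_zero[OF E(1) one] one
        by (auto simp: admissible_lifts_def residue_map_add scalar_product_torsion_map
            scalar_product_commute[of "torsion_map _"])
    qed
    then show ?thesis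
      by (simp add: card_admissible_lifts)
  qed
  then have "card (even_codes ({0} \<union> (+) ?one ` {0}) E) * card E =
      card (even_codes {0} E) * 2 ^ CARD('n)"
    using E(2) by (intro card_even_codes_adjoin) (auto simp: vec_eq_iff)
  then show ?thesis
    using even_codes_residue_zero[OF E(1) one] span_insert_bit[of ?one "{}"] by simp
qed

section \<open>Induction over a basis of the residue code\<close>

text \<open>The all-ones vector contributes the exponent \<open>m\<close>. Adjoining a vector to
  \<open>insert (\<chi> i. 1) S\<close> with \<open>card S = j\<close> contributes m - 2 - j, and
  summing over j < s gives s(2m - s - 3)/2.\<close>

lemma card_even_codes_span:
  fixes C1 C2 S :: "(bit ^ 'n) set"
  assumes n: "8 dvd CARD('n)" and C2: "vec.subspace C2"
    and sub: "C1 \<subseteq> C2" "C2 \<subseteq> binary_dual C1" and "doubly_even C1"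
    and S: "finite S" "(\<chi> i. 1) \<notin> S" "vec.independent (insert (\<chi> i. 1) S)"
      "insert (\<chi> i. 1) S \<subseteq> C1"
  defines "m \<equiv> real (CARD('n)) - real (vec.dim C2)"
  shows "real (card (even_codes (vec.span (insert (\<chi> i. 1) S)) C2)) =
    2 powr (m + card S * (2 * m - real (card S) - 3) / 2)"
  using S
proof (induction S rule: finite_induct)
  case empty
  then have "card (even_codes (vec.span {\<chi> i. 1}) C2) * 2 ^ vec.dim C2 = 2 ^ CARD('n)"
    using card_even_codes_span_one[OF n C2] sub card_subspace_bit[OF C2]
    by (auto simp: binary_dual_def)
  then have "real (card (even_codes (vec.span {\<chi> i. 1}) C2)) * 2 ^ vec.dim C2 = 2 ^ CARD('n)"
    by (metis of_nat_mult of_nat_numeral of_nat_power)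
  then have "real (card (even_codes (vec.span {\<chi> i. 1}) C2)) * 2 powr vec.dim C2 = 2 powr CARD('n)"
    by (simp add: powr_realpow)
  then show ?case
    by (simp add: m_def powr_diff field_simps)
next
  case (insert e S)
  let ?one = "\<chi> i. 1 :: bit ^ 'n"
  let ?S = "insert ?one S"
  have ind: "vec.independent (insert e ?S)" and "e \<noteq> ?one"
    using insert by (auto simp: insert_commute)
  then have e: "e \<notin> vec.span ?S" "vec.independent ?S"
    using insert by (simp_all add: vec.independent_insert)
  have IH: "real (card (even_codes (vec.span ?S) C2)) =
      2 powr (m + card S * (2 * m - real (card S) - 3) / 2)"
    using insert e by auto
  \<comment> \<open>A single \<open>K\<close> must serve for all codes over the span, so it is
    defined by a quotient; that the division is exact follows once one such code exists.\<close>
  define K :: nat where "K = 2 ^ CARD('n) div 2 ^ (card S + 2)"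
  have K: "card (admissible_lifts e C) * 2 ^ (card S + 2) = 2 ^ CARD('n)"
    if "C \<in> even_codes (vec.span ?S) C2" for C
  proof -
    have "card (admissible_lifts e C) * 2 ^ (card ?S + 1) = 2 ^ CARD('n)"
    proof (rule card_admissible_lifts_independent[OF that _ ind])
      show "scalar_product e c = 0" if "c \<in> C2" for c
        using that insert.prems sub by (auto simp: binary_dual_def)
      show "scalar_product x e = 0" if "x \<in> ?S" for x
        using that insert.prems sub by (auto simp: binary_dual_def)
      show "4 dvd hamming_weight e"
        using insert.prems \<open>doubly_even C1\<close> by (auto simp: doubly_even_def)
    qed (use insert \<open>e \<noteq> ?one\<close> in auto)
    then show ?thesis
      using insert by simp
  qed
  then have K_eq: "card (admissible_lifts e C) = K" if "C \<in> even_codes (vec.span ?S) C2" for C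
    unfolding K_def K[OF that, symmetric] by simp
  \<comment> \<open>By the induction hypothesis the number of codes is a power of 2, hence
    nonzero.\<close>
  have "even_codes (vec.span ?S) C2 \<noteq> {}"
    using IH by auto
  then have "K * 2 ^ (card S + 2) = 2 ^ CARD('n)"
    using K K_eq by fastforce
  moreover have "card (even_codes (vec.span ?S \<union> (+) e ` vec.span ?S) C2) * card C2 =
      card (even_codes (vec.span ?S) C2) * K"
    using e K_eq insert.prems sub by (intro card_even_codes_adjoin) auto
  ultimately have "card (even_codes (vec.span (insert e ?S)) C2) * (2 ^ vec.dim C2 * 2 ^ (card S + 2)) =
      card (even_codes (vec.span ?S) C2) * 2 ^ CARD('n)"
    by (simp add: span_insert_bit[of e ?S] card_subspace_bit[OF C2] flip: mult.assoc)
  from arg_cong[OF this, of real]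
  have "real (card (even_codes (vec.span (insert e ?S)) C2)) * (2 ^ vec.dim C2 * 2 ^ (card S + 2)) =
      2 powr (m + card S * (2 * m - real (card S) - 3) / 2) * 2 ^ CARD('n)"
    by (simp only: of_nat_mult of_nat_power of_nat_numeral IH)
  then have "real (card (even_codes (vec.span (insert e ?S)) C2)) *
      2 powr (real (vec.dim C2) + real (card S + 2)) =
      2 powr (m + card S * (2 * m - real (card S) - 3) / 2 + real CARD('n))"
    by (simp only: powr_add powr_realpow zero_less_numeral)
  then have "real (card (even_codes (vec.span (insert e ?S)) C2)) =
      2 powr (m + card S * (2 * m - real (card S) - 3) / 2 + real CARD('n) -
        (real (vec.dim C2) + real (card S + 2)))"
    by (simp only: powr_diff) (simp add: eq_divide_eq)
  also have "m + card S * (2 * m - real (card S) - 3) / 2 + real CARD('n) -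
        (real (vec.dim C2) + real (card S + 2)) =
      m + card (insert e S) * (2 * m - real (card (insert e S)) - 3) / 2"
    using insert.hyps by (simp add: m_def field_simps)
  finally show ?case
    by (simp add: insert_commute)
qed

theorem theorem5p7:
  fixes C1 C2 :: "(bit ^ 'n) set" and k1 k2 :: nat
  assumes "8 dvd CARD('n)"
    and "binary_code C1" and "binary_code C2"
    and "C1 \<subseteq> C2" and "C2 \<subseteq> binary_dual C1"
    and "doubly_even C1" and "(\<chi> i. 1) \<in> C1"
    and "vec.dim C1 = k1" and "vec.dim C2 = k1 + k2"
  shows "real (card {C :: (4 ^ 'n) set. even_quaternary_code C \<and> C \<inter> pm1_vectors \<noteq> {} \<and>
            residue_code C = C1 \<and> torsion_code C = C2}) =
         2 powr ((real CARD('n) - real k1 - real k2) +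
           (real k1 - 1) * (2 * real CARD('n) - 3 * real k1 - 2 - 2 * real k2) / 2)"
proof -
  have C1: "vec.subspace C1" and C2: "vec.subspace C2"
    using assms(2,3) by (simp_all add: binary_code_def)
  \<comment> \<open>Any codeword reducing to the all-ones vector has only odd coordinates.\<close>
  have "C \<inter> pm1_vectors \<noteq> {}" if "residue_code C = C1" for C
  proof -
    have "(\<chi> i. 1) \<in> residue_map ` C"
      using assms(7) that by (simp add: residue_code_def)
    then obtain v where v: "v \<in> C" "residue_map v = (\<chi> i. 1)"
      by (metis imageE)
    have "v $ i = 1 \<or> v $ i = -1" for i
      using v(2) Z4_cases[of "v $ i"] by (auto simp: vec_eq_iff reduce2_eq split: if_splits)
    then show ?thesis
      using v(1) by (auto simp: pm1_vectors_def)
  qed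
  then have eq: "{C. even_quaternary_code C \<and> C \<inter> pm1_vectors \<noteq> {} \<and>
      residue_code C = C1 \<and> torsion_code C = C2} = even_codes C1 C2"
    by (auto simp: even_codes_def)
  have "(\<chi> i. 1 :: bit ^ 'n) \<noteq> 0"
    by (simp add: vec_eq_iff)
  then have "vec.independent {\<chi> i. 1 :: bit ^ 'n}"
    by simp
  \<comment> \<open>A basis of \<open>C1\<close> through the all-ones vector; removing that vector
    leaves \<open>k1 - 1\<close> elements to adjoin.\<close>
  then obtain B where B: "{\<chi> i. 1} \<subseteq> B" "B \<subseteq> C1" "vec.independent B" "C1 \<subseteq> vec.span B"
    using vec.maximal_independent_subset_extend[of "{\<chi> i. 1}" C1] assms(7) by auto
  define S where "S = B - {\<chi> i. 1}"
  have BS: "B = insert (\<chi> i. 1) S"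
    using B(1) by (auto simp: S_def)
  have span: "vec.span B = C1"
    using B C1 by (simp add: vec.span_subspace)
  have "k1 = card B"
    using vec.dim_span_eq_card_independent[OF B(3)] span assms(8) by simp
  also have "\<dots> = card S + 1"
    using B(1) card_Suc_Diff1[of B "\<chi> i. 1"] by (simp add: S_def)
  finally have k1: "real (card S) = real k1 - 1"
    by simp
  have "real (card (even_codes C1 C2)) = 2 powr (real CARD('n) - real (k1 + k2) +
      (real k1 - 1) * (2 * (real CARD('n) - real (k1 + k2)) - (real k1 - 1) - 3) / 2)"
    using card_even_codes_span[OF assms(1) C2 assms(4-6), of S] B(2,3)
    unfolding BS[symmetric] span k1 assms(9) by (simp add: S_def)
  also have "real CARD('n) - real (k1 + k2) +
      (real k1 - 1) * (2 * (real CARD('n) - real (k1 + k2)) - (real k1 - 1) - 3) / 2 =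
      (real CARD('n) - real k1 - real k2) +
      (real k1 - 1) * (2 * real CARD('n) - 3 * real k1 - 2 - 2 * real k2) / 2"
    by (simp add: algebra_simps)
  finally show ?thesis
    unfolding eq .
qed

end
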